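(* Let $d\ge1$ and let $A=a_dx^d+a_{d-1}x^{d-1}+\cdots+a_1x+a_0\in\mathbb{Z}[x]$, $a_0\ge2$, be an expanding polynomial that is monic in the sense that $a_d\in\{1,-1\}$. Then $$\mathcal{G}_A(P)=V\Psi_A(P)+\mathcal{F}_A\quad\text{for all }P\in\mathcal{Q}.$$
   Context: A polynomial is expanding if all its complex roots have modulus strictly larger than $1$. Let $\mathcal{N}=\{0,\ldots,a_0-1\}$, $\mathcal{Q}=\mathbb{Z}[x]/A\mathbb{Z}[x]$, and let $X$ be the image of $x$ in $\mathcal{Q}$. The backward division mapping $D_A:\mathcal{Q}\to\mathcal{Q}$ is the well-defined map sending $P=\sum_{i=0}^\ell p_iX^i$ ($p_i\in\mathbb{Z}$) to $D_A(P)=\sum_{i=0}^{\ell-1}p_{i+1}X^i-\sum_{i=0}^{d-1}q\,a_{i+1}X^i$, $q=\lfloor p_0/a_0\rfloor$; $D_A^{-n}(P)$ denotes the preimage of $P$ under $D_A^n$. Let $W_0=a_d$ and $W_k=XW_{k-1}+a_{d-k}$ for $1\le k\le d-1$ (elements of $\mathcal{Q}$). The Brunotte module $\Lambda_A$ is the $\mathbb{Z}$-submodule of $\mathcal{Q}$ generated by $W_0,\ldots,W_{d-1}$ (which are a basis of it; for monic $A$ one has $\Lambda_A=\mathcal{Q}$), and $\Psi_A:\Lambda_A\to\mathbb{Z}^d$ is the bijection $\sum_{k=0}^{d-1}z_kW_k\mapsto(z_0,\ldots,z_{d-1})^t$. Let $\mathbf{r}=(r_0,\ldots,r_{d-1})=\big(\frac{a_d}{a_0},\frac{a_{d-1}}{a_0},\ldots,\frac{a_1}{a_0}\big)$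 and let $M_\mathbf{r}\in\mathbb{R}^{d\times d}$ be the matrix with last row $(-r_0,\ldots,-r_{d-1})$, entries $1$ on the superdiagonal of the first $d-1$ rows, and $0$ elsewhere. Let $V\in\mathbb{R}^{d\times d}$ be upper triangular with $V_{ij}=a_{d-(j-i)}$ for $1\le i\le j\le d$ and $V_{ij}=0$ for $i>j$, and $B=VM_\mathbf{r}^{-1}V^{-1}$. For $P\in\Lambda_A$ the Brunotte tile is $\mathcal{G}_A(P)=\mathrm{Li}_{n\to\infty}B^{-n}V\Psi_A\big(D_A^{-n}(P)\cap\Lambda_A\big)$, where the lower Hausdorff limit $\mathrm{Li}_{n\to\infty}A_n$ is the set of all $\mathbf{t}\in\mathbb{R}^d$ such that each neighbourhood of $\mathbf{t}$ intersects $A_n$ for all sufficiently large $n$. The self-affine tile associated with $A$ is $\mathcal{F}_A=\big\{\sum_{i=1}^\infty B^{-i}(c_i,0,\ldots,0)^t\mid c_i\in\mathcal{N}\big\}\subset\mathbb{R}^d$. *)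

theory Defs
  imports
    "HOL-Analysis.Analysis"
    "HOL-Computational_Algebra.Polynomial"
    "HOL-Algebra.QuotRing"
    "HOL-Algebra.Generated_Groups"
    "HOL-Decision_Procs.Algebra_Aux"
begin

definition expanding :: "int poly \<Rightarrow> bool" where
  "expanding A \<longleftrightarrow> (\<forall>z::complex. poly (map_poly of_int A) z = 0 \<longrightarrow> cmod z > 1)"


section \<open>The ring \<open>\<int>[x]/A\<int>[x]\<close> and backward division\<close>

text \<open>
  \<^const>\<open>cring_class_ops\<close> is the ring record of the type class operations, here on
  \<^typ>\<open>int poly\<close>. The elements of the quotient ring are thus sets of polynomials.
\<close>

abbreviation Zx :: "int poly ring" where
  "Zx \<equiv> cring_class_ops"

definition Q_ring :: "int poly \<Rightarrow> int poly set ring" where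
  "Q_ring A = Zx Quot (PIdl\<^bsub>Zx\<^esub> A)"

definition Q_class :: "int poly \<Rightarrow> int poly \<Rightarrow> int poly set" where
  "Q_class A p = PIdl\<^bsub>Zx\<^esub> A +>\<^bsub>Zx\<^esub> p"

lemma Q_class_conv: "Q_class A p = {r. A dvd r - p}"
proof (intro Set.set_eqI iffI)
  fix r assume "r \<in> Q_class A p"
  then show "r \<in> {r. A dvd r - p}"
    by (auto simp: Q_class_def a_r_coset_def' cgenideal_def class_simps)
next
  fix r assume "r \<in> {r. A dvd r - p}"
  then obtain g where "r - p = A * g" by (auto elim: dvdE)
  then have "r = g * A + p" by (simp add: algebra_simps)
  then show "r \<in> Q_class A p"
    by (auto simp: Q_class_def a_r_coset_def' cgenideal_def class_simps)
qed

lemma Q_class_eq_iff: "Q_class A p = Q_class A r \<longleftrightarrow> A dvd p - r"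
proof
  assume "Q_class A p = Q_class A r"
  moreover have "p \<in> Q_class A p" by (simp add: Q_class_conv)
  ultimately show "A dvd p - r" by (simp add: Q_class_conv)
next
  assume *: "A dvd p - r"
  have "A dvd s - p \<longleftrightarrow> A dvd s - r" for s
    using dvd_add_left_iff[OF *, of "s - p"] by simp
  then show "Q_class A p = Q_class A r" by (simp add: Q_class_conv)
qed

lemma carrier_Q_ring: "carrier (Q_ring A) = range (Q_class A)"
  by (auto simp: Q_ring_def Q_class_def FactRing_def A_RCOSETS_def' cring_class_ops_def)

text \<open>
  \<^term>\<open>poly_shift 1 p\<close> is \<open>\<Sum>i. p\<^bsub>i+1\<^esub> x\<^sup>i\<close>, and \<open>div\<close> on integers rounds towards minus infinity,
  so that it yields the floor of \<open>p\<^sub>0/a\<^sub>0\<close>.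
\<close>

definition bdiv_poly :: "int poly \<Rightarrow> int poly \<Rightarrow> int poly" where
  "bdiv_poly A p = poly_shift 1 p - smult (coeff p 0 div coeff A 0) (poly_shift 1 A)"

text \<open>
  The union collapses to the class of \<^term>\<open>bdiv_poly A p\<close> for any representative \<open>p\<close>;
  see \<open>bdiv_Q_class\<close> for the independence of the representative.
\<close>

definition bdiv :: "int poly \<Rightarrow> int poly set \<Rightarrow> int poly set" where
  "bdiv A P = (\<Union>p\<in>P. Q_class A (bdiv_poly A p))"

lemma bdiv_poly_cong:
  assumes "coeff A 0 \<noteq> 0"
  shows "bdiv_poly A (p + A * g) = bdiv_poly A p + A * poly_shift 1 g"
proof -
  obtain a A' where A: "A = pCons a A'" by (cases A)
  obtain b g' where g: "g = pCons b g'" by (cases g)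
  obtain c p' where p: "p = pCons c p'" by (cases p)
  have sh: "poly_shift 1 (pCons u v) = v" for u :: int and v
    by (simp add: poly_eq_iff coeff_poly_shift)
  have *: "p + A * g = pCons (c + a * b) (p' + smult b A' + A * g')"
    unfolding A g p by (simp add: algebra_simps)
  have "(c + a * b) div a = c div a + b"
    using assms by (simp add: A)
  then show ?thesis
    unfolding bdiv_poly_def * unfolding A g p sh
    by (simp add: smult_add_left algebra_simps)
qed

lemma bdiv_Q_class:
  assumes "coeff A 0 \<noteq> 0"
  shows "bdiv A (Q_class A p) = Q_class A (bdiv_poly A p)"
proof -
  have "Q_class A (bdiv_poly A r) = Q_class A (bdiv_poly A p)" if "r \<in> Q_class A p" for r
  proof -
    from that obtain g where "r - p = A * g" by (auto simp: Q_class_conv elim: dvdE)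
    then have "r = p + A * g" by (simp add: algebra_simps)
    then show ?thesis by (simp add: bdiv_poly_cong[OF assms] Q_class_eq_iff)
  qed
  moreover have "p \<in> Q_class A p" by (simp add: Q_class_conv)
  ultimately show ?thesis unfolding bdiv_def by blast
qed

definition bdiv_preimage :: "int poly \<Rightarrow> nat \<Rightarrow> int poly set \<Rightarrow> int poly set set" where
  "bdiv_preimage A n P = {R \<in> carrier (Q_ring A). (bdiv A ^^ n) R = P}"


section \<open>The Brunotte module\<close>

primrec W :: "int poly \<Rightarrow> nat \<Rightarrow> int poly set" where
  "W A 0 = Q_class A [:coeff A (degree A):]"
| "W A (Suc k) =
     Q_class A [:0, 1:] \<otimes>\<^bsub>Q_ring A\<^esub> W A k \<oplus>\<^bsub>Q_ring A\<^esub> Q_class A [:coeff A (degree A - Suc k):]"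

definition brunotte_module :: "int poly \<Rightarrow> int poly set set" where
  "brunotte_module A = generate (add_monoid (Q_ring A)) (W A ` {..<degree A})"

text \<open>
  \<open>\<real>\<^sup>d\<close> is \<^typ>\<open>real^'n\<close> for a finite linearly ordered index type with \<^term>\<open>CARD('n)\<close> equal
  to \<open>d\<close> (so that \<open>d \<ge> 1\<close>, types being nonempty); \<open>pos i\<close> is the zero-based position of
  the index \<open>i\<close>.
\<close>

definition pos :: "'n::{finite,linorder} \<Rightarrow> nat" where
  "pos i = card {..<i}"

lemma pos_less_iff: "pos i < pos j \<longleftrightarrow> i < j"
proof -
  have *: "pos i < pos j" if "i < j" for i j :: 'a
    unfolding pos_def using that by (intro psubset_card_mono) auto
  show ?thesis
    using *[of i j] *[of j i] by (cases i j rule: linorder_cases) auto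
qed

lemma bij_betw_pos: "bij_betw pos (UNIV :: 'n::{finite,linorder} set) {..<CARD('n)}"
proof -
  have inj: "inj (pos :: 'n \<Rightarrow> nat)"
    by (rule injI) (metis less_irrefl linorder_neqE pos_less_iff)
  have "pos i < CARD('n)" for i :: 'n
    unfolding pos_def by (intro psubset_card_mono) auto
  then have "range (pos :: 'n \<Rightarrow> nat) \<subseteq> {..<CARD('n)}" by auto
  moreover have "card (range (pos :: 'n \<Rightarrow> nat)) = CARD('n)"
    using inj by (rule card_image)
  ultimately have "range (pos :: 'n \<Rightarrow> nat) = {..<CARD('n)}"
    by (intro card_subset_eq) auto
  with inj show ?thesis by (simp add: bij_betw_def)
qed

definition W_comb :: "int poly \<Rightarrow> int^'n::{finite,linorder} \<Rightarrow> int poly set" where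
  "W_comb A z = (\<Oplus>\<^bsub>Q_ring A\<^esub>k\<in>UNIV. [z $ k] \<cdot>\<^bsub>Q_ring A\<^esub> W A (pos k))"

definition Psi :: "int poly \<Rightarrow> int poly set \<Rightarrow> int^'n::{finite,linorder}" where
  "Psi A = the_inv_into UNIV (W_comb A)"


section \<open>Matrices\<close>

definition M_mat :: "int poly \<Rightarrow> real^'n::{finite,linorder}^'n::{finite,linorder}" where
  "M_mat A = (\<chi> i j.
     if pos i = degree A - 1 then - (of_int (coeff A (degree A - pos j)) / of_int (coeff A 0))
     else if pos j = pos i + 1 then 1 else 0)"

definition V_mat :: "int poly \<Rightarrow> real^'n::{finite,linorder}^'n::{finite,linorder}" where
  "V_mat A = (\<chi> i j. if i \<le> j then of_int (coeff A (degree A - (pos j - pos i))) else 0)"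

definition B_mat :: "int poly \<Rightarrow> real^'n::{finite,linorder}^'n::{finite,linorder}" where
  "B_mat A = V_mat A ** matrix_inv (M_mat A) ** matrix_inv (V_mat A)"

text \<open>The type class power on \<^typ>\<open>real^'n^'n\<close> would be componentwise.\<close>

definition mat_power :: "real^'n^'n \<Rightarrow> nat \<Rightarrow> real^'n^'n" where
  "mat_power M n = (((**) M) ^^ n) (mat 1)"

definition V_Psi :: "int poly \<Rightarrow> int poly set \<Rightarrow> real^'n::{finite,linorder}" where
  "V_Psi A P = V_mat A *v (\<chi> i. of_int (Psi A P $ i))"


section \<open>Tiles\<close>

definition lower_Hausdorff_limit :: "(nat \<Rightarrow> 'a::topological_space set) \<Rightarrow> 'a set" where
  "lower_Hausdorff_limit S =
     {t. \<forall>U. open U \<longrightarrow> t \<in> U \<longrightarrow> (\<forall>\<^sub>F n in sequentially. U \<inter> S n \<noteq> {})}"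

definition brunotte_tile :: "int poly \<Rightarrow> int poly set \<Rightarrow> (real^'n::{finite,linorder}) set" where
  "brunotte_tile A P = lower_Hausdorff_limit
     (\<lambda>n. (\<lambda>R. mat_power (matrix_inv (B_mat A)) n *v V_Psi A R)
            ` (bdiv_preimage A n P \<inter> brunotte_module A))"

definition self_affine_tile :: "int poly \<Rightarrow> (real^'n::{finite,linorder}) set" where
  "self_affine_tile A = {s. \<exists>c :: nat \<Rightarrow> int.
     (\<forall>i\<ge>1. c i \<in> {0..coeff A 0 - 1}) \<and>
     (\<lambda>i. mat_power (matrix_inv (B_mat A)) (Suc i) *v
            (\<chi> k. if pos k = 0 then of_int (c (Suc i)) else 0)) sums s}"

end

theory Submission
  imports Defs "HOL-Complex_Analysis.Cauchy_Integral_Formula"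
begin

text \<open>
  The polynomials \<open>w\<^sub>k = \<Sum>i\<le>k. a\<^bsub>d-k+i\<^esub> x\<^sup>i\<close> represent the \<open>W\<^sub>k\<close>, so \<open>V\<close> is the change of basis
  to \<open>1, X, \<dots>, X\<^bsup>d-1\<^esup>\<close>: for \<open>a\<^sub>d = \<plusminus>1\<close>, \<open>V \<Psi>(P)\<close> is the coefficient vector of the remainder
  of \<open>P\<close> modulo \<open>A\<close>, and \<open>B\<close> is multiplication by \<open>X\<close> in these coordinates. Since \<open>D\<^sub>A(R) = P\<close>
  holds exactly when \<open>R = X P + c\<close> with a digit \<open>c\<close>, the \<open>n\<close>-th set of the Hausdorff limit is
  \<open>V \<Psi>(P)\<close> plus the partial sums of length \<open>n\<close> of the series that define the self-affine tile.
  The coordinates of \<open>X\<^bsup>-n\<^esup>\<close> satisfy the linear recurrence with characteristic polynomial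
  reciprocal to \<open>A\<close>, hence are summable because \<open>A\<close> is expanding; so the series converge uniformly
  on the compact space of digit sequences and the tile is compact.
\<close>

section \<open>The Brunotte basis\<close>

lemma pos_less_CARD: "pos (i :: 'n::{finite,linorder}) < CARD('n)"
  using bij_betw_pos[where 'n='n] by (auto simp: bij_betw_def)

lemma pos_inject [simp]: "pos (i :: 'n::{finite,linorder}) = pos j \<longleftrightarrow> i = j"
  using bij_betw_pos[where 'n='n] by (auto simp: bij_betw_def inj_on_def)

lemma pos_surj:
  assumes "m < CARD('n::{finite,linorder})"
  obtains k :: "'n::{finite,linorder}" where "pos k = m"
  using assms bij_betw_pos[where 'n='n] unfolding bij_betw_def by (metis imageE lessThan_iff)

context
  fixes A :: "int poly"
begin

section \<open>Arithmetic of residue classes carried out on representatives\<close>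

lemma cring_Q_ring: "cring (Q_ring A)"
  unfolding Q_ring_def
  by (intro ideal.quotient_is_cring cring.cgenideal_ideal cring_class) (simp add: carrier_class)

lemma Q_class_ring_hom: "Q_class A \<in> ring_hom Zx (Q_ring A)"
proof -
  have "ideal (PIdl\<^bsub>Zx\<^esub> A) Zx"
    by (intro cring.cgenideal_ideal cring_class) (simp add: carrier_class)
  from ideal.rcos_ring_hom[OF this] show ?thesis
    by (simp add: Q_ring_def Q_class_def[abs_def])
qed

lemma Q_class_carrier [simp]: "Q_class A p \<in> carrier (Q_ring A)"
  by (simp add: carrier_Q_ring)

lemma Q_class_add: "Q_class A p \<oplus>\<^bsub>Q_ring A\<^esub> Q_class A q = Q_class A (p + q)"
  using ring_hom_add[OF Q_class_ring_hom, of p q] by (simp add: carrier_class plus_class)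

lemma Q_class_mult: "Q_class A p \<otimes>\<^bsub>Q_ring A\<^esub> Q_class A q = Q_class A (p * q)"
  using ring_hom_mult[OF Q_class_ring_hom, of p q] by (simp add: carrier_class times_class)

lemma Q_class_zero: "\<zero>\<^bsub>Q_ring A\<^esub> = Q_class A 0"
  using ring_hom_zero[OF Q_class_ring_hom cring.axioms(1)[OF cring_class] cring.axioms(1)[OF cring_Q_ring]]
  by (simp add: zero_class)

lemma Q_class_neg: "\<ominus>\<^bsub>Q_ring A\<^esub> Q_class A p = Q_class A (- p)"
  by (rule abelian_group.minus_equality[OF ring.is_abelian_group[OF cring.axioms(1)[OF cring_Q_ring]]])
     (simp_all add: Q_class_add Q_class_zero)

lemma Q_class_finsum:
  "finite I \<Longrightarrow> (\<Oplus>\<^bsub>Q_ring A\<^esub>k\<in>I. Q_class A (f k)) = Q_class A (\<Sum>k\<in>I. f k)"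
proof (induction I rule: finite_induct)
  interpret cring "Q_ring A" by (rule cring_Q_ring)
  case empty
  show ?case by (simp add: Q_class_zero)
next
  interpret cring "Q_ring A" by (rule cring_Q_ring)
  case (insert k I)
  then show ?case by (simp add: Q_class_add)
qed

lemma Q_class_add_pow: "[(z::int)] \<cdot>\<^bsub>Q_ring A\<^esub> Q_class A p = Q_class A (smult z p)"
proof -
  interpret cring "Q_ring A" by (rule cring_Q_ring)
  have nat: "[(n::nat)] \<cdot>\<^bsub>Q_ring A\<^esub> Q_class A p = Q_class A (smult (int n) p)" for n
    by (induction n) (simp_all add: Q_class_zero Q_class_add smult_add_left add.commute)
  show ?thesis
  proof (cases z)
    case (nonneg n)
    then show ?thesis using nat[of n] by (simp add: add_pow_def int_pow_int)
  next
    case (neg n)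
    have "[(- int (Suc n))] \<cdot>\<^bsub>Q_ring A\<^esub> Q_class A p
          = \<ominus>\<^bsub>Q_ring A\<^esub> ([(int (Suc n))] \<cdot>\<^bsub>Q_ring A\<^esub> Q_class A p)"
      by (rule add.int_pow_neg) simp
    also have "[(int (Suc n))] \<cdot>\<^bsub>Q_ring A\<^esub> Q_class A p = Q_class A (smult (int (Suc n)) p)"
      using nat[of "Suc n"] by (simp only: add_pow_def int_pow_int)
    finally show ?thesis by (simp only: neg Q_class_neg smult_minus_left)
  qed
qed

text \<open>Horner's scheme: the recursion of \<open>W A\<close> rebuilds \<open>A\<close> from its
  leading coefficient downwards, and after k steps it has reached the polynomial part of
  \<open>A\<close> divided by x^(d-k).\<close>

lemma W_eq_Q_class: "k \<le> degree A \<Longrightarrow> W A k = Q_class A (poly_shift (degree A - k) A)"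
proof (induction k)
  case 0
  have "poly_shift (degree A) A = [:coeff A (degree A):]"
    by (auto simp: poly_eq_iff coeff_poly_shift coeff_pCons coeff_eq_0 split: nat.split)
  then show ?case by simp
next
  case (Suc k)
  have "poly_shift (degree A - Suc k) A
        = [:0, 1:] * poly_shift (degree A - k) A + [:coeff A (degree A - Suc k):]"
    using Suc.prems by (auto simp: poly_eq_iff coeff_poly_shift coeff_pCons Suc_diff_Suc split: nat.split)
  then show ?case using Suc by (simp add: Q_class_mult Q_class_add)
qed

text \<open>Representative of \<open>W_comb A z\<close> of degree below \<open>degree A\<close>, so
  that equality of classes can be decided by comparing coefficients.\<close>

definition W_poly :: "int^'n::{finite,linorder} \<Rightarrow> int poly" where
  "W_poly z = (\<Sum>k\<in>UNIV. smult (z $ k) (poly_shift (degree A - pos k) A))"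

lemma W_poly_add: "W_poly (y + z) = W_poly y + W_poly z"
  by (simp add: W_poly_def smult_add_left sum.distrib)

lemma coeff_W_poly: "coeff (W_poly z) i = (\<Sum>k\<in>UNIV. z $ k * coeff A (i + (degree A - pos k)))"
  by (simp add: W_poly_def coeff_sum coeff_poly_shift)

lemma W_comb_eq:
  assumes "degree A = CARD('n::{finite,linorder})"
  shows "W_comb A (z :: int^'n::{finite,linorder}) = Q_class A (W_poly z)"
proof -
  have "W A (pos k) = Q_class A (poly_shift (degree A - pos k) A)" for k :: 'n
    using pos_less_CARD[of k] assms by (intro W_eq_Q_class) simp
  then show ?thesis
    by (simp add: W_comb_def W_poly_def Q_class_add_pow Q_class_finsum)
qed

lemma degree_W_poly: 
  assumes "degree A = CARD('n::{finite,linorder})"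
  shows "degree (W_poly (z :: int^'n::{finite,linorder})) < degree A"
proof (cases "W_poly z = 0")
  case False
  have "coeff (W_poly z) i = 0" if "i \<ge> degree A" for i
  proof -
    have "degree A < i + (degree A - pos k)" for k :: 'n
      using that pos_less_CARD[of k] assms by linarith
    then show ?thesis by (simp add: coeff_W_poly coeff_eq_0)
  qed
  with False show ?thesis by (meson leading_coeff_0_iff not_le)
qed (simp add: assms)

text \<open>Triangular elimination: the shift with index k has degree k and leading coefficient
  \<open>lead_coeff A\<close>, a unit, so the coefficients of r can be cleared from the top
  downwards.\<close>

lemma W_poly_surj:
  assumes deg: "degree A = CARD('n::{finite,linorder})" and lead: "lead_coeff A \<in> {1, -1}"
    and r: "degree r < degree A"
  shows "\<exists>z :: int^'n::{finite,linorder}. W_poly z = r"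
proof -
  \<comment> \<open>The degree bound is expressed by vanishing coefficients, so that m = 0 forces r
    = 0.\<close>
  have "\<exists>z :: (int, 'n) vec. W_poly z = r" if "m \<le> degree A" "\<forall>i\<ge>m. coeff r i = 0" for m r
    using that
  proof (induction m arbitrary: r)
    case 0
    then have "W_poly (0 :: (int,'n) vec) = r" by (simp add: W_poly_def poly_eq_iff)
    then show ?case ..
  next
    case (Suc m)
    then obtain k :: 'n where k: "pos k = m" using pos_surj deg by (metis Suc_le_lessD)
    \<comment> \<open>The leading coefficient is its own inverse, so this factor makes the shift
      cancel the coefficient of x^m in r.\<close>
    define c where "c = coeff r m * lead_coeff A"
    have sq: "lead_coeff A * lead_coeff A = 1" using lead by auto
    have "\<forall>i\<ge>m. coeff (r - smult c (poly_shift (degree A - m) A)) i = 0"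
    proof (intro allI impI)
      fix i assume "i \<ge> m"
      show "coeff (r - smult c (poly_shift (degree A - m) A)) i = 0"
      proof (cases "i = m")
        case True
        then show ?thesis using Suc.prems sq by (simp add: coeff_poly_shift c_def mult.assoc)
      next
        case False
        then show ?thesis using Suc.prems \<open>i \<ge> m\<close> by (simp add: coeff_poly_shift coeff_eq_0)
      qed
    qed
    then obtain z :: "(int,'n) vec" where z: "W_poly z = r - smult c (poly_shift (degree A - m) A)"
      using Suc.IH Suc.prems(1) by (meson Suc_leD)
    have "W_poly (axis k c) = (\<Sum>j\<in>UNIV. if j = k then smult c (poly_shift (degree A - pos k) A) else 0)"
      unfolding W_poly_def by (intro sum.cong) (auto simp: axis_def)
    then have "W_poly (z + axis k c) = r"
      by (simp add: W_poly_add z k)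
    then show ?case ..
  qed
  from this[of "degree A" r] r show ?thesis by (simp add: coeff_eq_0)
qed

end

section \<open>Matrices\<close>

text \<open>Preimages of the unit vectors are the columns of a right inverse, and a one-sided
  inverse of a square matrix is two-sided.\<close>

lemma invertible_if_axis_in_range:
  fixes M :: "real^'n^'n"
  assumes "\<And>j. \<exists>v. M *v v = axis j 1"
  shows "invertible M"
proof -
  obtain f where f: "M *v f j = axis j 1" for j using assms by metis
  have "M ** (\<chi> i j. f j $ i) = mat 1"
  proof -
    have "(M ** (\<chi> i j. f j $ i)) $ i $ j = (M *v f j) $ i" for i j
      by (simp add: matrix_matrix_mult_def matrix_vector_mult_def)
    then show ?thesis by (simp add: f vec_eq_iff axis_def mat_def)
  qed
  then show ?thesis using invertible_right_inverse by blast
qed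

lemma matrix_inv_mult:
  assumes "invertible M"
  shows "M ** matrix_inv M = mat 1" "matrix_inv M ** M = mat 1"
  using someI_ex[OF assms[unfolded invertible_def]] by (simp_all add: matrix_inv_def)

lemma invertible_matrix_inv: "invertible M \<Longrightarrow> invertible (matrix_inv M)"
  using matrix_inv_mult invertible_def by blast

lemma mat_power_vector: "mat_power M n *v v = (((*v) M) ^^ n) v"
proof (induction n)
  case 0
  show ?case by (simp add: mat_power_def)
next
  case (Suc n)
  have "mat_power M (Suc n) = M ** mat_power M n" by (simp add: mat_power_def)
  then show ?case using Suc by (simp flip: matrix_vector_mul_assoc)
qed

section \<open>Coordinates and multiplication by \<open>X\<close>\<close>

text \<open>The parameter \<open>dim\<close> fixes the index type \<open>'n\<close>, which
  \<open>A\<close> itself does not mention.\<close>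

locale unit_lead_poly =
  fixes A :: "int poly" and dim :: "'n::{finite,linorder} itself"
  assumes degree_eq: "degree A = CARD('n)"
    and lead_unit: "lead_coeff A \<in> {1, -1}"
    and const_pos: "coeff A 0 > 0"
begin

abbreviation cls :: "int poly \<Rightarrow> int poly set" where
  "cls \<equiv> Q_class A"

definition real_vec :: "(int, 'n) vec \<Rightarrow> (real, 'n) vec" where
  "real_vec z = (\<chi> i. of_int (z $ i))"

definition coeff_vec :: "int poly \<Rightarrow> (real, 'n) vec" where
  "coeff_vec p = (\<chi> i. of_int (coeff p (pos i)))"

text \<open>The argument is a polynomial instead of a class, so that linearity can be stated with
  the operations of \<open>int poly\<close>.\<close>

definition cvec :: "int poly \<Rightarrow> (real, 'n) vec" where
  "cvec p = V_Psi A (cls p)"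

definition inv_B :: "((real, 'n) vec, 'n) vec" where
  "inv_B = matrix_inv (B_mat A)"

lemma degree_pos: "degree A > 0"
  by (simp add: degree_eq)

lemma lead_sq: "lead_coeff A * lead_coeff A = 1"
  using lead_unit by auto

text \<open>Column j of V lists the coefficients of the polynomial representing
  \<open>W A (pos j)\<close>; the zeros below the diagonal are coefficients of \<open>A\<close>
  beyond its degree.\<close>

lemma V_mat_mult: "V_mat A *v real_vec z = coeff_vec (W_poly A z)"
proof -
  have "(if i \<le> j then real_of_int (coeff A (degree A - (pos j - pos i))) else 0)
        = of_int (coeff A (pos i + (degree A - pos j)))" for i j :: 'n
  proof (cases "i \<le> j")
    case True
    then have "pos i \<le> pos j" by (metis le_less pos_less_iff order_refl)
    then show ?thesis using True pos_less_CARD[of j] degree_eq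
      by (auto intro!: arg_cong[where f = "coeff A"])
  next
    case False
    then have "pos j < pos i" by (simp add: pos_less_iff)
    then have "degree A < pos i + (degree A - pos j)" by linarith
    then show ?thesis using False by (simp add: coeff_eq_0)
  qed
  then show ?thesis
    by (simp add: vec_eq_iff V_mat_def real_vec_def coeff_vec_def matrix_vector_mult_def
        coeff_W_poly mult.commute)
qed

lemma coeff_vec_monom: "coeff_vec (monom 1 (pos j)) = axis j 1"
  by (auto simp: vec_eq_iff coeff_vec_def axis_def)

lemma invertible_V: "invertible (V_mat A :: ((real, 'n) vec, 'n) vec)"
proof (rule invertible_if_axis_in_range)
  fix j :: 'n
  have "degree (monom (1 :: int) (pos j)) < degree A"
    using degree_monom_le[of "1::int" "pos j"] pos_less_CARD[of j] degree_eq by simp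
  then obtain z :: "(int, 'n) vec" where "W_poly A z = monom 1 (pos j)"
    using W_poly_surj[OF degree_eq lead_unit] by blast
  then have "V_mat A *v real_vec z = axis j 1"
    by (simp add: V_mat_mult coeff_vec_monom)
  then show "\<exists>v. V_mat A *v v = (axis j 1 :: (real, 'n) vec)" ..
qed

text \<open>Congruent polynomials of degree below \<open>degree A\<close> are equal, and V is
  invertible. Hence \<open>Psi\<close>, defined by \<open>the_inv_into\<close>, really inverts
  \<open>W_comb A\<close>.\<close>

lemma inj_W_comb: "inj (W_comb A :: (int, 'n) vec \<Rightarrow> _)"
proof (rule injI)
  fix y z :: "(int, 'n) vec"
  assume "W_comb A y = W_comb A z"
  then have "A dvd W_poly A y - W_poly A z"
    by (simp add: W_comb_eq degree_eq Q_class_eq_iff)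
  moreover have "degree (W_poly A y - W_poly A z) < degree A"
    by (intro degree_diff_less degree_W_poly degree_eq degree_pos)
  ultimately have "W_poly A y - W_poly A z = 0"
    using dvd_imp_degree_le not_le by blast
  then have "V_mat A *v real_vec y = V_mat A *v real_vec z" by (simp add: V_mat_mult)
  then have "real_vec y = real_vec z"
    by (metis invertible_V matrix_inv_mult(2) matrix_vector_mul_assoc matrix_vector_mul_lid)
  then show "y = z" by (simp add: real_vec_def vec_eq_iff)
qed

lemma V_Psi_cls_W_poly: "V_Psi A (cls (W_poly A z)) = V_mat A *v real_vec z"
proof -
  have "Psi A (cls (W_poly A z)) = z"
    unfolding Psi_def by (metis W_comb_eq[OF degree_eq] inj_W_comb the_inv_f_f)
  then show ?thesis by (simp add: V_Psi_def real_vec_def)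
qed

section \<open>Linearity of the coordinate map\<close>

lemma cvec_eq_coeff_vec: "degree p < degree A \<Longrightarrow> cvec p = coeff_vec p"
  using W_poly_surj[OF degree_eq lead_unit] V_Psi_cls_W_poly V_mat_mult unfolding cvec_def by metis

text \<open>Pseudo-division stands in for division with remainder over the integers: it scales p by
  a power of the leading coefficient, which is \<plusminus>1 and is undone by scaling once
  more.\<close>

lemma cls_reduced: obtains r where "degree r < degree A" "cls p = cls r"
proof -
  obtain q r where qr: "pseudo_divmod p A = (q, r)" by fastforce
  define e where "e = lead_coeff A ^ (Suc (degree p) - degree A)"
  have e: "e * e = 1" using lead_unit by (auto simp: e_def simp flip: power_mult_distrib)
  have "A \<noteq> 0" using degree_pos by auto
  note pd = pseudo_divmod[OF this qr, folded e_def]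
  have "p = smult (e * e) p" by (simp add: e)
  also have "\<dots> = A * smult e q + smult e r"
    using pd(1) by (simp flip: smult_smult add: smult_add_right)
  finally have "A dvd p - smult e r" by (metis add_diff_cancel_right' dvd_triv_left)
  moreover have "degree (smult e r) < degree A"
    using pd(2) degree_pos by (auto intro: le_less_trans[OF degree_smult_le])
  ultimately show ?thesis using that Q_class_eq_iff by blast
qed

lemma cvec_cong: "cls p = cls q \<Longrightarrow> cvec p = cvec q"
  by (simp add: cvec_def)

lemma cvec_add: "cvec (p + q) = cvec p + cvec q"
proof -
  obtain p' q' where *: "degree p' < degree A" "cls p = cls p'" "degree q' < degree A" "cls q = cls q'"
    using cls_reduced by metis
  then have "cls (p + q) = cls (p' + q')" by (metis Q_class_add)
  then have "cvec (p + q) = coeff_vec (p' + q')"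
    by (metis * cvec_cong cvec_eq_coeff_vec degree_add_less)
  also have "\<dots> = coeff_vec p' + coeff_vec q'" by (simp add: coeff_vec_def vec_eq_iff)
  finally show ?thesis by (metis * cvec_cong cvec_eq_coeff_vec)
qed

lemma cvec_smult: "cvec (smult c p) = of_int c *\<^sub>R cvec p"
proof -
  obtain p' where *: "degree p' < degree A" "cls p = cls p'"
    using cls_reduced by metis
  then have "cls (smult c p) = cls (smult c p')" by (metis Q_class_add_pow)
  then have "cvec (smult c p) = coeff_vec (smult c p')"
    using * by (metis cvec_cong cvec_eq_coeff_vec degree_smult_le le_less_trans)
  also have "\<dots> = of_int c *\<^sub>R coeff_vec p'" by (simp add: coeff_vec_def vec_eq_iff)
  finally show ?thesis by (metis * cvec_cong cvec_eq_coeff_vec)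
qed

lemma cvec_sum: "finite I \<Longrightarrow> cvec (\<Sum>i\<in>I. f i) = (\<Sum>i\<in>I. cvec (f i))"
proof (induction I rule: finite_induct)
  case empty
  show ?case using cvec_smult[of 0 0] by simp
qed (simp add: cvec_add)

lemma cvec_const: "cvec [:c:] = (\<chi> k. if pos k = 0 then of_int c else 0)"
  using degree_pos by (auto simp: cvec_eq_coeff_vec coeff_vec_def vec_eq_iff coeff_pCons split: nat.split)

section \<open>Multiplication by X in coordinates\<close>

lemma sum_pos: "(\<Sum>k\<in>UNIV. f (pos (k :: 'n))) = (\<Sum>m<degree A. f m)"
  using sum.reindex_bij_betw[OF bij_betw_pos[where 'n='n], of f] by (simp add: degree_eq)

text \<open>Since X W_m = W_(m+1) - a_(d-m-1), and W_d is the class of \<open>A\<close> and hence 0,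
  multiplication by X shifts the coordinates up and leaves a constant, which is a multiple of W_0 =
  \<plusminus>1. The matrix M undoes this, its last row recovering the coordinate that was shifted
  out.\<close>

lemma mult_X_coords:
  "\<exists>z'. M_mat A *v real_vec z' = real_vec z \<and> cls ([:0, 1:] * W_poly A z) = cls (W_poly A z')"
proof -
  define y where "y m = z $ inv_into UNIV pos m" for m
  have y: "z $ k = y (pos k)" for k
    using bij_betw_pos[where 'n='n] by (simp add: y_def bij_betw_def)
  define w where "w m = poly_shift (degree A - m) A" for m
  \<comment> \<open>Collects the constants split off in \<open>w_Suc\<close>; the entry
    \<open>y' 0\<close> has to express \<open>- s\<close> as a multiple of
    \<open>w 0\<close>.\<close>
  define s where "s = (\<Sum>m<degree A. y m * coeff A (degree A - Suc m))"
  define y' where "y' m = (case m of 0 \<Rightarrow> - lead_coeff A * s | Suc m \<Rightarrow> y m)" for m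
  define z' :: "(int, 'n) vec" where "z' = (\<chi> k. y' (pos k))"
  obtain e where e: "degree A = Suc e" using degree_pos by (cases "degree A") auto
  have w0: "w 0 = [:lead_coeff A:]"
    by (auto simp: w_def poly_eq_iff coeff_poly_shift coeff_pCons coeff_eq_0 split: nat.split)
  have wd: "w (Suc e) = A"
    by (simp add: w_def e poly_eq_iff coeff_poly_shift)
  have w_Suc: "[:0, 1:] * w m = w (Suc m) - [:coeff A (degree A - Suc m):]" if "m < degree A" for m
    using that by (auto simp: w_def poly_eq_iff coeff_poly_shift coeff_pCons Suc_diff_Suc split: nat.split)
  have Wz: "W_poly A z = (\<Sum>m<degree A. smult (y m) (w m))"
    unfolding W_poly_def y w_def by (rule sum_pos)
  have "W_poly A z' = (\<Sum>m<degree A. smult (y' m) (w m))"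
    unfolding W_poly_def z'_def w_def
    by (simp add: sum_pos[of "\<lambda>m. smult (y' m) (poly_shift (degree A - m) A)"])
  also have "\<dots> = smult (y' 0) (w 0) + (\<Sum>m<e. smult (y m) (w (Suc m)))"
    unfolding e by (subst sum.lessThan_Suc_shift) (simp add: y'_def)
  also have "smult (y' 0) (w 0) = - [:s:]"
    using lead_sq by (simp add: w0 y'_def mult.commute mult.left_commute)
  finally have Wz': "W_poly A z' = - [:s:] + (\<Sum>m<e. smult (y m) (w (Suc m)))" .
  have "[:0, 1:] * W_poly A z = (\<Sum>m<degree A. smult (y m) ([:0, 1:] * w m))"
    unfolding Wz sum_distrib_left by (simp only: mult_smult_right)
  also have "\<dots> = (\<Sum>m<degree A. smult (y m) (w (Suc m)) - [:y m * coeff A (degree A - Suc m):])"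
    by (intro sum.cong) (simp_all only: w_Suc smult_diff_right lessThan_iff smult_pCons smult_0_right)
  also have "\<dots> = (\<Sum>m<degree A. smult (y m) (w (Suc m))) - [:s:]"
    by (simp add: sum_subtractf s_def sum_to_poly)
  also have "\<dots> = W_poly A z' + smult (y e) A"
    unfolding Wz' e by (simp add: wd)
  finally have "cls ([:0, 1:] * W_poly A z) = cls (W_poly A z')"
    by (simp add: Q_class_eq_iff smult_dvd_iff dvd_smult)
  moreover have "M_mat A *v real_vec z' = real_vec z"
  proof -
    have "(M_mat A *v real_vec z') $ i = real_of_int (z $ i)" for i
    proof -
      define g where "g m = (if pos i = e then - (of_int (coeff A (degree A - m)) / of_int (coeff A 0))
        else if m = pos i + 1 then 1 else 0) * real_of_int (y' m)" for m
      have "(M_mat A *v real_vec z') $ i = (\<Sum>m<degree A. g m)"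
        unfolding sum_pos[symmetric]
        by (simp add: M_mat_def matrix_vector_mult_def real_vec_def z'_def g_def e cong: if_cong)
      also have "\<dots> = of_int (y (pos i))"
      proof (cases "pos i = e")
        case True
        \<comment> \<open>Last row: clearing the denominator \<open>coeff A 0\<close> reduces the
          claim to the definition of s, whose final summand is
          \<open>y e * coeff A 0\<close>.\<close>
        have "of_int (coeff A 0) * (\<Sum>m<degree A. g m)
              = - of_int (\<Sum>m<degree A. coeff A (degree A - m) * y' m)"
        proof -
          have "of_int (coeff A 0) * g m = - of_int (coeff A (degree A - m) * y' m)" for m
          proof -
            have "g m = - (of_int (coeff A (degree A - m)) / of_int (coeff A 0)) * of_int (y' m)"
              by (simp only: g_def True if_True simp_thms)
            moreover have "c * (- (x / c) * t) = - (x * t)" if "c \<noteq> 0" for c x t :: real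
              using that by simp
            moreover have "real_of_int (coeff A 0) \<noteq> 0" using const_pos by simp
            ultimately show ?thesis by (simp only: of_int_mult)
          qed
          then show ?thesis by (simp only: sum_distrib_left sum_negf of_int_sum)
        qed
        also have "(\<Sum>m<degree A. coeff A (degree A - m) * y' m)
            = lead_coeff A * y' 0 + (\<Sum>m<e. coeff A (degree A - Suc m) * y m)"
          unfolding e by (subst sum.lessThan_Suc_shift) (simp add: y'_def)
        also have "lead_coeff A * y' 0 = - s"
          unfolding y'_def
          by (simp only: nat.case mult_minus_left mult_minus_right mult.assoc[symmetric] lead_sq mult_1_left)
        also have "s = (\<Sum>m<e. coeff A (degree A - Suc m) * y m) + y e * coeff A 0"
          by (simp add: s_def e mult.commute)
        finally show ?thesis using const_pos True by simp
      next
        case False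
        have "pos i < Suc e" using pos_less_CARD[of i] degree_eq e by simp
        then have "Suc (pos i) < degree A" using False e by simp
        then have "(\<Sum>m<degree A. g m) = (\<Sum>m<degree A. if m = Suc (pos i) then of_int (y' m) else 0)"
          using False by (intro sum.cong) (auto simp: g_def)
        also have "\<dots> = of_int (y (pos i))"
          using \<open>Suc (pos i) < degree A\<close> by (simp add: y'_def)
        finally show ?thesis .
      qed
      finally show ?thesis by (simp add: y)
    qed
    then show ?thesis by (simp add: vec_eq_iff real_vec_def)
  qed
  ultimately show ?thesis by blast
qed

lemma invertible_M: "invertible (M_mat A :: ((real, 'n) vec, 'n) vec)"
proof (rule invertible_if_axis_in_range)
  fix j :: 'n
  have "real_vec (axis j 1) = axis j 1"
    by (simp add: real_vec_def axis_def vec_eq_iff)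
  then show "\<exists>v. M_mat A *v v = (axis j 1 :: (real, 'n) vec)"
    using mult_X_coords by metis
qed

lemma inv_B_mult_B: "inv_B ** B_mat A = mat 1"
  unfolding inv_B_def B_mat_def
  by (intro matrix_inv_mult invertible_mult invertible_matrix_inv invertible_M invertible_V)

text \<open>By \<open>mult_X_coords\<close> the inverse of M is multiplication by X in the basis of
  the W_k; conjugating with V moves it to the coordinates \<open>cvec\<close>, so
  \<open>inv_B\<close> divides by X.\<close>

lemma inv_B_cvec_mult_X: "inv_B *v cvec ([:0, 1:] * p) = cvec p"
proof -
  obtain p' where "degree p' < degree A" "cls p = cls p'"
    using cls_reduced by metis
  then obtain z :: "(int, 'n) vec" where z: "cls p = cls (W_poly A z)"
    using W_poly_surj[OF degree_eq lead_unit] by metis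
  obtain z' where z': "M_mat A *v real_vec z' = real_vec z"
      "cls ([:0, 1:] * W_poly A z) = cls (W_poly A z')"
    using mult_X_coords by blast
  have "cls ([:0, 1:] * p) = cls (W_poly A z')"
    by (metis z z'(2) Q_class_mult)
  then have "cvec ([:0, 1:] * p) = V_mat A *v real_vec z'"
    by (simp only: cvec_def V_Psi_cls_W_poly)
  also have "real_vec z' = matrix_inv (M_mat A) *v real_vec z"
    by (metis z'(1) invertible_M matrix_inv_mult(2) matrix_vector_mul_assoc matrix_vector_mul_lid)
  also have "V_mat A *v (matrix_inv (M_mat A) *v real_vec z) = B_mat A *v (V_mat A *v real_vec z)"
    unfolding B_mat_def matrix_vector_mul_assoc
    by (simp add: matrix_inv_mult(2)[OF invertible_V] flip: matrix_mul_assoc)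
  also have "V_mat A *v real_vec z = cvec p"
    by (simp only: cvec_def z V_Psi_cls_W_poly)
  finally show ?thesis
    by (simp add: matrix_vector_mul_assoc inv_B_mult_B)
qed

text \<open>Every class has a reduced representative, and that is an integral combination of the
  W_k, so the module is the whole quotient.\<close>

lemma in_brunotte_module: "cls p \<in> brunotte_module A"
proof -
  interpret cring "Q_ring A" by (rule cring_Q_ring)
  have W_carrier: "W A ` {..<degree A} \<subseteq> carrier (Q_ring A)"
    by (auto simp: W_eq_Q_class)
  then have sub: "subgroup (brunotte_module A) (add_monoid (Q_ring A))"
    unfolding brunotte_module_def by (intro add.generate_is_subgroup) simp
  obtain z :: "(int, 'n) vec" where z: "cls p = cls (W_poly A z)"
    using W_poly_surj[OF degree_eq lead_unit] cls_reduced by metis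
  have W: "cls (smult c (poly_shift (degree A - pos k) A)) \<in> brunotte_module A" for c and k :: 'n
  proof -
    have "pos k < degree A" using pos_less_CARD[of k] degree_eq by simp
    then have "cls (poly_shift (degree A - pos k) A) \<in> brunotte_module A"
      unfolding brunotte_module_def by (auto intro!: generate.incl simp flip: W_eq_Q_class)
    then have "[c] \<cdot>\<^bsub>Q_ring A\<^esub> cls (poly_shift (degree A - pos k) A) \<in> brunotte_module A"
      by (rule add.subgroup_int_pow_closed[OF sub])
    then show ?thesis by (simp add: Q_class_add_pow)
  qed
  have "cls (\<Sum>k\<in>I. smult (z $ k) (poly_shift (degree A - pos k) A)) \<in> brunotte_module A" for I :: "'n set"
    using finite[of I]
  proof (induction I rule: finite_induct)
    case empty
    then show ?case using subgroup.one_closed[OF sub] by (simp add: Q_class_zero)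
  next
    case (insert k I)
    then show ?case
      using subgroup.m_closed[OF sub W[of "z $ k" k] insert.IH] by (simp add: Q_class_add)
  qed
  then show ?thesis unfolding z W_poly_def .
qed

section \<open>Coordinates of the powers X^-n and their recurrence\<close>

definition inv_pow :: "nat \<Rightarrow> (real, 'n) vec" where
  "inv_pow n = (((*v) inv_B) ^^ n) (cvec 1)"

lemma inv_B_pow_add: "(((*v) inv_B) ^^ n) (v + w) = (((*v) inv_B) ^^ n) v + (((*v) inv_B) ^^ n) w"
  by (induction n) (simp_all add: matrix_vector_right_distrib)

lemma inv_B_pow_scaleR: "(((*v) inv_B) ^^ n) (c *\<^sub>R v) = c *\<^sub>R (((*v) inv_B) ^^ n) v"
  by (induction n) (simp_all add: matrix_vector_mult_scaleR)

lemma inv_B_pow_sum: "finite I \<Longrightarrow> (((*v) inv_B) ^^ n) (\<Sum>i\<in>I. f i) = (\<Sum>i\<in>I. (((*v) inv_B) ^^ n) (f i))"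
proof (induction I rule: finite_induct)
  case empty
  show ?case using inv_B_pow_scaleR[of n 0 0] by simp
qed (simp add: inv_B_pow_add)

lemma inv_B_pow_cvec_monom: "(((*v) inv_B) ^^ j) (cvec (monom 1 j)) = cvec 1"
proof (induction j)
  case (Suc j)
  have "monom 1 (Suc j) = [:0, 1:] * monom (1::int) j" by (simp add: monom_Suc)
  then have "inv_B *v cvec (monom 1 (Suc j)) = cvec (monom 1 j)" by (simp only: inv_B_cvec_mult_X)
  then show ?case using Suc by (simp only: funpow_Suc_right o_apply)
qed (simp add: one_pCons)

text \<open>Applying \<open>inv_B\<close> n times to the coordinates of \<open>A\<close>, which
  vanish, turns x^j into X^-(n-j).\<close>

lemma inv_pow_recurrence:
  assumes "n \<ge> degree A"
  shows "(\<Sum>j\<le>degree A. of_int (coeff A j) *\<^sub>R inv_pow (n - j)) = 0"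
proof -
  have u: "inv_pow (n - j) = (((*v) inv_B) ^^ n) (cvec (monom 1 j))" if "j \<le> degree A" for j
  proof -
    have "(((*v) inv_B) ^^ n) (cvec (monom 1 j)) = (((*v) inv_B) ^^ (n - j)) ((((*v) inv_B) ^^ j) (cvec (monom 1 j)))"
      using that assms funpow_add[of "n - j" j "(*v) inv_B"] by simp
    then show ?thesis by (simp only: inv_pow_def inv_B_pow_cvec_monom)
  qed
  have "cvec A = cvec (\<Sum>j\<le>degree A. smult (coeff A j) (monom 1 j))"
    using poly_as_sum_of_monoms[of A] by (simp add: smult_monom)
  then have A: "cvec A = (\<Sum>j\<le>degree A. of_int (coeff A j) *\<^sub>R cvec (monom 1 j))"
    by (simp add: cvec_sum cvec_smult)
  have "cvec A = cvec 0" by (intro cvec_cong) (simp add: Q_class_eq_iff)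
  then have A0: "cvec A = 0" using cvec_smult[of 0 0] by simp
  have "(\<Sum>j\<le>degree A. of_int (coeff A j) *\<^sub>R inv_pow (n - j)) = (((*v) inv_B) ^^ n) (cvec A)"
    by (simp add: A inv_B_pow_sum inv_B_pow_scaleR u)
  then show ?thesis using A0 inv_B_pow_sum[of "{}" n] by simp
qed

end

section \<open>Digit series\<close>

lemma expanding_root_gap:
  assumes "expanding p" "coeff p 0 \<noteq> 0"
  obtains r where "r > 1" "\<And>z :: complex. poly (map_poly of_int p) z = 0 \<Longrightarrow> norm z \<ge> r"
proof -
  \<comment> \<open>The element 2 keeps the set nonempty when p has no roots.\<close>
  define R where "R = insert 2 (norm ` {z :: complex. poly (map_poly of_int p) z = 0})"
  have "coeff (map_poly complex_of_int p) 0 \<noteq> 0"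
    using assms(2) by (simp add: coeff_map_poly)
  then have "map_poly complex_of_int p \<noteq> 0" by fastforce
  then have "finite R" by (simp add: R_def poly_roots_finite)
  moreover have "\<forall>x\<in>R. x > 1" using assms(1) by (auto simp: R_def expanding_def)
  moreover have "R \<noteq> {}" by (simp add: R_def)
  ultimately have "Min R > 1" by simp
  moreover have "norm z \<ge> Min R" if "poly (map_poly of_int p) z = 0" for z :: complex
    using that \<open>finite R\<close> by (intro Min_le) (auto simp: R_def)
  ultimately show ?thesis using that by blast
qed

text \<open>
  The generating function of such a sequence is a polynomial divided by \<open>p\<close>, hence its
  radius of convergence is at least the smallest modulus of a root of \<open>p\<close>.
\<close>

lemma summable_expanding_recurrence:
  fixes s :: "nat \<Rightarrow> real"
  assumes "expanding p" "coeff p 0 \<noteq> 0"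
    and rec: "\<And>n. n \<ge> degree p \<Longrightarrow> (\<Sum>j\<le>degree p. of_int (coeff p j) * s (n - j)) = 0"
  shows "summable (\<lambda>n. \<bar>s n\<bar>)"
proof -
  obtain r where r: "r > 1" "\<And>z :: complex. poly (map_poly of_int p) z = 0 \<Longrightarrow> norm z \<ge> r"
    using expanding_root_gap[OF assms(1,2)] by blast
  define F where "F = fps_of_poly (map_poly complex_of_int p)"
  define U where "U = Abs_fps (\<lambda>n. complex_of_real (s n))"
  \<comment> \<open>The numerator: the part of \<open>F * U\<close> below \<open>degree p\<close>;
    the recurrence makes all further coefficients vanish.\<close>
  define g where "g = (\<Sum>i<degree p. monom (fps_nth (F * U) i) i)"
  have F_nth: "fps_nth F i = of_int (coeff p i)" for i
    by (simp add: F_def coeff_map_poly)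
  have high: "fps_nth (F * U) n = 0" if "n \<ge> degree p" for n
  proof -
    have "fps_nth (F * U) n = (\<Sum>j\<le>n. fps_nth F j * fps_nth U (n - j))"
      by (simp add: fps_mult_nth atLeast0AtMost)
    also have "\<dots> = (\<Sum>j\<le>degree p. fps_nth F j * fps_nth U (n - j))"
      using that by (intro sum.mono_neutral_right) (auto simp: F_nth coeff_eq_0)
    also have "\<dots> = of_real (\<Sum>j\<le>degree p. of_int (coeff p j) * s (n - j))"
      by (simp add: F_nth U_def)
    finally show ?thesis using rec[OF that] by simp
  qed
  have FU: "F * U = fps_of_poly g"
  proof (rule fps_ext)
    fix n
    have "fps_nth (fps_of_poly g) n = (\<Sum>i<degree p. if i = n then fps_nth (F * U) i else 0)"
      by (simp add: g_def coeff_sum)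
    also have "\<dots> = fps_nth (F * U) n" using high[of n] by simp
    finally show "fps_nth (F * U) n = fps_nth (fps_of_poly g) n" ..
  qed
  have F0: "fps_nth F 0 \<noteq> 0" using assms(2) by (simp add: F_nth)
  have "inverse F * (F * U) = (inverse F * F) * U" by (simp only: mult.assoc)
  then have U: "U = inverse F * fps_of_poly g"
    using inverse_mult_eq_1[OF F0] by (simp add: FU)
  have "ereal r = min (ereal r) (fps_conv_radius F)" by (simp add: F_def)
  \<comment> \<open>No zero of \<open>F\<close> lies in the open disc of radius r, so the inverse
    series converges there.\<close>
  also have "\<dots> \<le> fps_conv_radius (inverse F)"
    using r(2) by (intro fps_conv_radius_inverse) (auto simp: F_def not_le[symmetric])
  also have "\<dots> = min (fps_conv_radius (inverse F)) (fps_conv_radius (fps_of_poly g))" by simp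
  also have "\<dots> \<le> fps_conv_radius U" unfolding U by (rule fps_conv_radius_mult)
  finally have "ereal r \<le> fps_conv_radius U" .
  with r(1) have "ereal (norm (1 :: complex)) < fps_conv_radius U"
    by (metis ereal_less(3) less_ereal.simps(1) norm_one order_less_le_trans)
  from norm_summable_fps[OF this] show ?thesis by (simp add: U_def)
qed

section \<open>Compactness and Hausdorff limits of sets of digit sums\<close>

lemma compact_digit_sums:
  fixes v :: "nat \<Rightarrow> 'a::banach" and S :: "real set"
  assumes "finite S" "summable (\<lambda>i. norm (v i))"
  shows "compact ((\<lambda>c. \<Sum>i. c i *\<^sub>R v i) ` (UNIV \<rightarrow> S))"
proof (rule compact_continuous_image)
  \<comment> \<open>Tychonoff: digit sequences form a product of finite sets.\<close>
  have "compactin (product_topology (\<lambda>_::nat. euclidean) UNIV) (PiE UNIV (\<lambda>_. S))"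
    unfolding compactin_PiE using finite_imp_compact[OF assms(1)] by simp
  then show "compact (UNIV \<rightarrow> S :: (nat \<Rightarrow> real) set)"
    by (simp add: euclidean_product_topology PiE_UNIV_domain)
  obtain b where b: "\<And>x. x \<in> S \<Longrightarrow> \<bar>x\<bar> \<le> b"
    using finite_imp_bounded[OF assms(1)] by (auto simp: bounded_iff)
  \<comment> \<open>Digits are bounded by b, so the M-test makes the series a uniform limit of
    continuous partial sums.\<close>
  have "uniform_limit (UNIV \<rightarrow> S) (\<lambda>n c. \<Sum>i<n. c i *\<^sub>R v i) (\<lambda>c. \<Sum>i. c i *\<^sub>R v i) sequentially"
    using b by (intro Weierstrass_m_test[where M = "\<lambda>i. b * norm (v i)"] summable_mult assms(2))
      (auto intro!: mult_right_mono)
  moreover have "continuous_on (UNIV \<rightarrow> S) (\<lambda>c. \<Sum>i<n. c i *\<^sub>R v i)" for n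
    by (intro continuous_intros continuous_on_subset[OF continuous_on_product_coordinates]) auto
  ultimately show "continuous_on (UNIV \<rightarrow> S) (\<lambda>c. \<Sum>i. c i *\<^sub>R v i)"
    by (intro uniform_limit_theorem[OF _ _ sequentially_bot]) auto
qed

text \<open>Padding with the digit 0 puts all approximating sets inside the closed set of full sums,
  so the limit cannot leave it; conversely a full sum is approached by its own partial sums.\<close>

lemma lower_Hausdorff_limit_digit_sums:
  fixes v :: "nat \<Rightarrow> 'a::banach" and S :: "real set"
  assumes "finite S" "0 \<in> S" "summable (\<lambda>i. norm (v i))"
  shows "lower_Hausdorff_limit (\<lambda>n. (\<lambda>c. w + (\<Sum>i<n. c i *\<^sub>R v i)) ` (UNIV \<rightarrow> S))
         = (\<lambda>t. w + t) ` (\<lambda>c. \<Sum>i. c i *\<^sub>R v i) ` (UNIV \<rightarrow> S)"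
    (is "lower_Hausdorff_limit ?T = ?F")
proof (intro Set.equalityI Set.subsetI)
  have "closed ?F"
    by (intro compact_imp_closed compact_translation compact_digit_sums assms)
  have sub: "?T n \<subseteq> ?F" for n
  proof
    fix t assume "t \<in> ?T n"
    then obtain c where c: "c \<in> UNIV \<rightarrow> S" "t = w + (\<Sum>i<n. c i *\<^sub>R v i)" by blast
    define c' where "c' i = (if i < n then c i else 0)" for i
    have "(\<Sum>i. c' i *\<^sub>R v i) = (\<Sum>i<n. c' i *\<^sub>R v i)"
      by (intro suminf_finite) (auto simp: c'_def)
    also have "\<dots> = (\<Sum>i<n. c i *\<^sub>R v i)" by (simp add: c'_def)
    finally have "t = w + (\<Sum>i. c' i *\<^sub>R v i)" using c by simp
    moreover have "c' \<in> UNIV \<rightarrow> S" using c assms(2) by (auto simp: c'_def)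
    ultimately show "t \<in> ?F" by blast
  qed
  fix t assume t: "t \<in> lower_Hausdorff_limit ?T"
  show "t \<in> ?F"
  proof (rule ccontr)
    assume "t \<notin> ?F"
    then have "\<forall>\<^sub>F n in sequentially. - ?F \<inter> ?T n \<noteq> {}"
      using t \<open>closed ?F\<close> by (auto simp: lower_Hausdorff_limit_def)
    then obtain n where "- ?F \<inter> ?T n \<noteq> {}"
      using eventually_happens'[OF sequentially_bot] by blast
    then show False using sub[of n] by blast
  qed
next
  fix t assume "t \<in> ?F"
  then obtain c where c: "c \<in> UNIV \<rightarrow> S" "t = w + (\<Sum>i. c i *\<^sub>R v i)" by blast
  obtain b where b: "\<And>x. x \<in> S \<Longrightarrow> \<bar>x\<bar> \<le> b"
    using finite_imp_bounded[OF assms(1)] by (auto simp: bounded_iff)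
  have "summable (\<lambda>i. c i *\<^sub>R v i)"
    using b c(1) by (intro summable_comparison_test'[OF summable_mult[OF assms(3), of b]])
      (auto intro!: mult_right_mono)
  then have lim: "(\<lambda>n. w + (\<Sum>i<n. c i *\<^sub>R v i)) \<longlonglongrightarrow> t"
    unfolding c(2) by (intro tendsto_add tendsto_const summable_LIMSEQ)
  show "t \<in> lower_Hausdorff_limit ?T"
    unfolding lower_Hausdorff_limit_def
  proof (intro CollectI allI impI)
    fix U assume "open U" "t \<in> U"
    with lim have "\<forall>\<^sub>F n in sequentially. w + (\<Sum>i<n. c i *\<^sub>R v i) \<in> U"
      by (rule topological_tendstoD)
    then show "\<forall>\<^sub>F n in sequentially. U \<inter> ?T n \<noteq> {}"
      by (rule eventually_mono) (use c(1) in blast)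
  qed
qed

section \<open>The tiles\<close>

context unit_lead_poly
begin

section \<open>Backward division as removal of a digit\<close>

lemma bdiv_cls: "bdiv A (cls p) = cls (bdiv_poly A p)"
  using const_pos by (intro bdiv_Q_class) simp

text \<open>Division with remainder of the constant coefficient by a_0: the remainder is the digit,
  the quotient is the multiple of \<open>A\<close> that is removed.\<close>

lemma cls_bdiv_poly: "cls p = cls ([:0, 1:] * bdiv_poly A p + [:coeff p 0 mod coeff A 0:])"
proof -
  have "p = [:0, 1:] * bdiv_poly A p + [:coeff p 0 mod coeff A 0:] + smult (coeff p 0 div coeff A 0) A"
    by (auto simp: poly_eq_iff bdiv_poly_def coeff_pCons coeff_poly_shift mod_div_mult_eq split: nat.split)
  then have "p - ([:0, 1:] * bdiv_poly A p + [:coeff p 0 mod coeff A 0:]) = smult (coeff p 0 div coeff A 0) A"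
    by (metis add_diff_cancel_left')
  then show ?thesis by (simp only: Q_class_eq_iff dvd_smult dvd_refl)
qed

text \<open>Backward division undoes R = X P + c because a digit c has quotient 0 by a_0.\<close>

lemma bdiv_poly_digit:
  assumes "c \<in> {0..coeff A 0 - 1}"
  shows "bdiv_poly A ([:0, 1:] * p + [:c:]) = p"
proof -
  have "c div coeff A 0 = 0" using assms by simp
  then show ?thesis
    by (simp add: bdiv_poly_def poly_eq_iff coeff_poly_shift)
qed

lemma inv_B_cvec_digit: "inv_B *v cvec ([:0, 1:] * p + [:c:]) = cvec p + of_int c *\<^sub>R inv_pow 1"
proof -
  have "cvec [:c:] = of_int c *\<^sub>R cvec 1"
    using cvec_smult[of c 1] by simp
  then show ?thesis
    by (simp only: cvec_add matrix_vector_right_distrib inv_B_cvec_mult_X matrix_vector_mult_scaleR)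
       (simp add: inv_pow_def)
qed

lemma inv_B_pow_inv_pow: "(((*v) inv_B) ^^ n) (inv_pow 1) = inv_pow (Suc n)"
  by (simp add: inv_pow_def funpow_swap1)

text \<open>Each backward division removes a digit c from X P + c, while \<open>inv_B\<close> turns
  X P + c into P + c X^-1; after n steps the digits form a partial sum over negative powers.\<close>

lemma bdiv_orbit_digits:
  assumes "(bdiv A ^^ n) (cls r) = cls p"
  shows "\<exists>c :: nat \<Rightarrow> int. range c \<subseteq> {0..coeff A 0 - 1} \<and>
           (((*v) inv_B) ^^ n) (cvec r) = cvec p + (\<Sum>i<n. of_int (c i) *\<^sub>R inv_pow (Suc i))"
  using assms
proof (induction n arbitrary: r)
  case 0
  then show ?case using const_pos by (intro exI[of _ "\<lambda>_. 0"]) (auto intro: cvec_cong)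
next
  case (Suc n)
  define b where "b = coeff r 0 mod coeff A 0"
  have b: "b \<in> {0..coeff A 0 - 1}" using const_pos by (simp add: b_def)
  have "(bdiv A ^^ n) (cls (bdiv_poly A r)) = cls p"
    using Suc.prems unfolding funpow_Suc_right by (simp add: bdiv_cls)
  then obtain c :: "nat \<Rightarrow> int" where c: "range c \<subseteq> {0..coeff A 0 - 1}"
      "(((*v) inv_B) ^^ n) (cvec (bdiv_poly A r)) = cvec p + (\<Sum>i<n. of_int (c i) *\<^sub>R inv_pow (Suc i))"
    using Suc.IH by blast
  have "(((*v) inv_B) ^^ Suc n) (cvec r) = (((*v) inv_B) ^^ n) (cvec (bdiv_poly A r) + of_int b *\<^sub>R inv_pow 1)"
    unfolding funpow_Suc_right o_apply cvec_cong[OF cls_bdiv_poly[of r]] inv_B_cvec_digit b_def ..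
  also have "\<dots> = cvec p + (\<Sum>i<n. of_int (c i) *\<^sub>R inv_pow (Suc i)) + of_int b *\<^sub>R inv_pow (Suc n)"
    by (simp only: inv_B_pow_add inv_B_pow_scaleR inv_B_pow_inv_pow c(2))
  \<comment> \<open>The digit removed first is divided by X most often, so it takes the last
    position n, and the digits from the induction hypothesis keep theirs.\<close>
  also have "\<dots> = cvec p + (\<Sum>i<Suc n. of_int ((c(n := b)) i) *\<^sub>R inv_pow (Suc i))"
    by simp
  finally show ?case using b c(1) by (intro exI[of _ "c(n := b)"]) auto
qed

text \<open>The preimage is built by taking in the digits in the order c 0, c 1, and so on: each
  later one becomes the new constant term and meets a higher negative power.\<close>

lemma digits_bdiv_orbit:
  fixes c :: "nat \<Rightarrow> int"
  assumes "range c \<subseteq> {0..coeff A 0 - 1}"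
  shows "\<exists>r. (bdiv A ^^ n) (cls r) = cls p \<and>
           (((*v) inv_B) ^^ n) (cvec r) = cvec p + (\<Sum>i<n. of_int (c i) *\<^sub>R inv_pow (Suc i))"
proof (induction n)
  case 0
  show ?case by auto
next
  case (Suc n)
  then obtain r where r: "(bdiv A ^^ n) (cls r) = cls p"
      "(((*v) inv_B) ^^ n) (cvec r) = cvec p + (\<Sum>i<n. of_int (c i) *\<^sub>R inv_pow (Suc i))" by blast
  let ?r = "[:0, 1:] * r + [:c n:]"
  have "c n \<in> {0..coeff A 0 - 1}" using assms by blast
  then have "(bdiv A ^^ Suc n) (cls ?r) = cls p"
    unfolding funpow_Suc_right o_apply bdiv_cls by (simp only: bdiv_poly_digit r(1))
  moreover have "(((*v) inv_B) ^^ Suc n) (cvec ?r) = cvec p + (\<Sum>i<Suc n. of_int (c i) *\<^sub>R inv_pow (Suc i))"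
    unfolding funpow_Suc_right o_apply inv_B_cvec_digit inv_B_pow_add inv_B_pow_scaleR inv_B_pow_inv_pow r(2) by simp
  ultimately show ?case by blast
qed

definition digits :: "real set" where
  "digits = of_int ` {0..coeff A 0 - 1}"

lemma int_digits: "c \<in> UNIV \<rightarrow> digits \<longleftrightarrow> (\<exists>b. range b \<subseteq> {0..coeff A 0 - 1} \<and> c = (\<lambda>i. of_int (b i)))"
proof
  assume "c \<in> UNIV \<rightarrow> digits"
  then have "\<forall>i. \<exists>b. b \<in> {0..coeff A 0 - 1} \<and> c i = of_int b" unfolding digits_def by blast
  then show "\<exists>b. range b \<subseteq> {0..coeff A 0 - 1} \<and> c = (\<lambda>i. of_int (b i))"
    unfolding choice_iff by blast
qed (auto simp: digits_def)

text \<open>The two inclusions come from \<open>bdiv_orbit_digits\<close> and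
  \<open>digits_bdiv_orbit\<close>; the left side is the n-th set in the lower limit that defines
  the Brunotte tile.\<close>

lemma preimage_image:
  "(\<lambda>R. mat_power inv_B n *v V_Psi A R) ` (bdiv_preimage A n (cls p) \<inter> brunotte_module A)
   = (\<lambda>c. cvec p + (\<Sum>i<n. c i *\<^sub>R inv_pow (Suc i))) ` (UNIV \<rightarrow> digits)" (is "?L = ?R")
proof (intro Set.equalityI Set.subsetI)
  fix t assume "t \<in> ?L"
  then obtain r where r: "(bdiv A ^^ n) (cls r) = cls p" "t = (((*v) inv_B) ^^ n) (cvec r)"
    by (auto simp: bdiv_preimage_def carrier_Q_ring mat_power_vector cvec_def)
  obtain c :: "nat \<Rightarrow> int" where "range c \<subseteq> {0..coeff A 0 - 1}"
      "t = cvec p + (\<Sum>i<n. of_int (c i) *\<^sub>R inv_pow (Suc i))"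
    using bdiv_orbit_digits[OF r(1)] unfolding r(2) by blast
  then show "t \<in> ?R" by (intro image_eqI[of _ _ "\<lambda>i. of_int (c i)"]) (auto simp: int_digits)
next
  fix t assume "t \<in> ?R"
  then obtain c :: "nat \<Rightarrow> int" where c: "range c \<subseteq> {0..coeff A 0 - 1}"
      "t = cvec p + (\<Sum>i<n. of_int (c i) *\<^sub>R inv_pow (Suc i))"
    by (auto simp: int_digits)
  obtain r where r: "(bdiv A ^^ n) (cls r) = cls p" "t = (((*v) inv_B) ^^ n) (cvec r)"
    using digits_bdiv_orbit[OF c(1), of n p] unfolding c(2)[symmetric] by auto
  then have "t = mat_power inv_B n *v V_Psi A (cls r)"
    by (simp add: mat_power_vector cvec_def)
  moreover have "cls r \<in> bdiv_preimage A n (cls p) \<inter> brunotte_module A"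
    using r(1) by (simp add: bdiv_preimage_def in_brunotte_module)
  ultimately show "t \<in> ?L" by blast
qed

section \<open>The tiles as convergent digit series\<close>

lemma summable_norm_inv_pow:
  assumes "expanding A"
  shows "summable (\<lambda>i. norm (inv_pow i))"
proof -
  have "summable (\<lambda>n. \<bar>inv_pow n $ k\<bar>)" for k
  proof (rule summable_expanding_recurrence[OF assms])
    show "coeff A 0 \<noteq> 0" using const_pos by simp
    show "(\<Sum>j\<le>degree A. of_int (coeff A j) * inv_pow (n - j) $ k) = 0" if "degree A \<le> n" for n
      using arg_cong[OF inv_pow_recurrence[OF that], of "\<lambda>v. v $ k"] by simp
  qed
  then have "summable (\<lambda>n. \<Sum>k\<in>UNIV. \<bar>inv_pow n $ k\<bar>)" by (intro summable_sum)
  then show ?thesis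
    by (rule summable_comparison_test') (simp add: norm_le_l1_cart)
qed

text \<open>Every digit series converges absolutely, so \<open>sums\<close> in the definition of the
  tile can be replaced by \<open>suminf\<close>; \<open>digit_term\<close> rewrites its terms by
  \<open>inv_pow\<close>.\<close>

lemma self_affine_tile_eq:
  assumes "expanding A"
  shows "(self_affine_tile A :: (real, 'n) vec set) = (\<lambda>c. \<Sum>i. c i *\<^sub>R inv_pow (Suc i)) ` (UNIV \<rightarrow> digits)"
proof -
  have digit_term: "mat_power (matrix_inv (B_mat A)) (Suc i) *v (\<chi> k. if pos k = 0 then of_int b else 0)
      = of_int b *\<^sub>R inv_pow (Suc i)" for i b
  proof -
    have "cvec [:b:] = of_int b *\<^sub>R cvec 1" using cvec_smult[of b 1] by simp
    then have "(\<chi> k. if pos k = 0 then of_int b else 0) = of_int b *\<^sub>R cvec 1"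
      by (simp add: cvec_const)
    then show ?thesis
      by (simp only: inv_B_def[symmetric] mat_power_vector inv_B_pow_scaleR inv_pow_def)
  qed
  have summable: "summable (\<lambda>i. c i *\<^sub>R inv_pow (Suc i))" if "c \<in> UNIV \<rightarrow> digits" for c
  proof (rule summable_comparison_test'[where g = "\<lambda>i. of_int (coeff A 0) * norm (inv_pow (Suc i))"])
    show "summable (\<lambda>i. of_int (coeff A 0) * norm (inv_pow (Suc i)))"
      by (intro summable_mult)
         (simp add: summable_Suc_iff[of "\<lambda>i. norm (inv_pow i)"] summable_norm_inv_pow[OF assms])
    show "norm (c i *\<^sub>R inv_pow (Suc i)) \<le> of_int (coeff A 0) * norm (inv_pow (Suc i))" for i
    proof -
      have "c i \<in> digits" using that by blast
      then show ?thesis by (auto simp: digits_def intro!: mult_right_mono)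
    qed
  qed
  show ?thesis
  proof (intro Set.equalityI Set.subsetI)
    fix s :: "(real, 'n) vec" assume "s \<in> self_affine_tile A"
    then obtain c :: "nat \<Rightarrow> int" where c: "\<forall>i\<ge>1. c i \<in> {0..coeff A 0 - 1}"
        "(\<lambda>i. of_int (c (Suc i)) *\<^sub>R inv_pow (Suc i)) sums s"
      unfolding self_affine_tile_def digit_term by blast
    then have "s = (\<Sum>i. of_int (c (Suc i)) *\<^sub>R inv_pow (Suc i))" by (simp add: sums_iff)
    moreover have "(\<lambda>i. of_int (c (Suc i))) \<in> UNIV \<rightarrow> digits" using c(1) by (auto simp: digits_def)
    ultimately show "s \<in> (\<lambda>c. \<Sum>i. c i *\<^sub>R inv_pow (Suc i)) ` (UNIV \<rightarrow> digits)"
      by (intro image_eqI[of _ _ "\<lambda>i. of_int (c (Suc i))"]) simp_all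
  next
    fix s assume "s \<in> (\<lambda>c. \<Sum>i. c i *\<^sub>R inv_pow (Suc i)) ` (UNIV \<rightarrow> digits)"
    then obtain b where b: "b \<in> UNIV \<rightarrow> digits" "s = (\<Sum>i. b i *\<^sub>R inv_pow (Suc i))" by blast
    have sums: "(\<lambda>i. b i *\<^sub>R inv_pow (Suc i)) sums s"
      using summable_sums[OF summable[OF b(1)]] unfolding b(2) .
    obtain c :: "nat \<Rightarrow> int" where c: "range c \<subseteq> {0..coeff A 0 - 1}" "b = (\<lambda>i. of_int (c i))"
      using iffD1[OF int_digits b(1)] by (elim exE conjE)
    show "s \<in> self_affine_tile A"
      unfolding self_affine_tile_def digit_term mem_Collect_eq
    \<comment> \<open>The tile numbers its digits from 1 and the series from 0, hence the shift by
      one.\<close>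
    proof (intro exI[of _ "\<lambda>i. c (i - 1)"] conjI)
      show "\<forall>i\<ge>1. c (i - 1) \<in> {0..coeff A 0 - 1}" using c(1) by blast
      show "(\<lambda>i. of_int (c (Suc i - 1)) *\<^sub>R inv_pow (Suc i)) sums s"
        using sums by (simp add: c(2))
    qed
  qed
qed

lemma brunotte_tile_eq:
  assumes "expanding A"
  shows "(brunotte_tile A (cls p) :: (real, 'n) vec set) = (\<lambda>t. V_Psi A (cls p) + t) ` self_affine_tile A"
proof -
  have "summable (\<lambda>i. norm (inv_pow (Suc i)))"
    using summable_norm_inv_pow[OF assms] by (subst summable_Suc_iff)
  moreover have "finite digits" "0 \<in> digits" using const_pos by (auto simp: digits_def image_iff)
  ultimately show ?thesis
    unfolding brunotte_tile_def inv_B_def[symmetric] preimage_image self_affine_tile_eq[OF assms]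
    by (subst lower_Hausdorff_limit_digit_sums) (auto simp: cvec_def)
qed

end

theorem corollary5p14:
  fixes A :: "int poly"
  assumes "degree A = CARD('n::{finite,linorder})"
    and "coeff A 0 \<ge> 2"
    and "expanding A"
    and "lead_coeff A \<in> {1, -1}"
  shows "\<forall>P \<in> carrier (Q_ring A).
    (brunotte_tile A P :: (real^'n::{finite,linorder}) set) = (\<lambda>t. V_Psi A P + t) ` self_affine_tile A"
proof -
  interpret unit_lead_poly A "TYPE('n)"
    using assms by unfold_locales auto
  show ?thesis
    using brunotte_tile_eq[OF assms(3)] by (auto simp: carrier_Q_ring)
qed

end
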